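(* Let $X$ be a compact metric space, $f:X\to X$ a continuous map, and let $\mu,\mu_o,\mu_1$ be Borel probability measures on $X$ (not necessarily $f$-invariant) such that $\mu=t\,\mu_o+(1-t)\,\mu_1$ with $t\in(0,1)$. Then for any $\mathrm{Scl}\in\{\mathrm{Dim},\mathrm{Ord}\}$, $$\overline{\mathrm{Scl}}\,\mathscr E_\mu(f)=\max\{\overline{\mathrm{Scl}}\,\mathscr E_{\mu_o}(f),\ \overline{\mathrm{Scl}}\,\mathscr E_{\mu_1}(f)\},$$ $$\overline{\mathrm{Scl}}\,\mathscr E'_\mu(f)=\max\{\overline{\mathrm{Scl}}\,\mathscr E'_{\mu_o}(f),\ \overline{\mathrm{Scl}}\,\mathscr E'_{\mu_1}(f)\}.$$
   Context: $\mathcal M(X)$ is the space of Borel probability measures on $X$ with the Kantorovich–Wasserstein distance $\mathsf d(\mu_1,\mu_2)=\sup_{\phi\ 1\text{-Lipschitz}}\int\phi\,d(\mu_1-\mu_2)$. The empirical measures are $\mathsf e^f_n(x)=\frac1n\sum_{0\le k<n}\delta_{f^k(x)}$. For a probability measure $\mu$ on $X$, the metric emergence $\mathscr E_\mu(f)(\epsilon)$ is the minimal number $N$ of measures $\nu_1,\dots,\nu_N\in\mathcal M(X)$ with $\limsup_{n\to\infty}\int\min_{1\le i\le N}\mathsf d(\mathsf e^f_n(x),\nu_i)\,d\mu(x)<\epsilon$, and the $2^{nd}$-metric emergence $\mathscr E'_\mu(f)(\epsilon)$ is the minimal number $N$ of measures $\nu_1,\dots,\nu_N\in\mathcal M(X)$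 with $\int\limsup_{n\to\infty}\min_{1\le i\le N}\mathsf d(\mathsf e^f_n(x),\nu_i)\,d\mu(x)<\epsilon$; both are functions of $\epsilon>0$. For $\varphi:(0,\infty)\to(0,\infty)$: $\overline{\mathrm{Dim}}\,\varphi=\limsup_{\epsilon\to0}\frac{|\log\varphi(\epsilon)|}{|\log\epsilon|}$ and $\overline{\mathrm{Ord}}\,\varphi=\limsup_{\epsilon\to0}\frac{\log|\log\varphi(\epsilon)|}{|\log\epsilon|}$, with the convention that the order is $0$ if $\varphi(\epsilon)=1$ for all sufficiently small $\epsilon$. *)

theory Defs
  imports "HOL-Probability.Probability"
begin

text \<open>The compact metric space \<open>X\<close> is the universe of a type of class \<^class>\<open>metric_space\<close>, assumed to
  be compact. Its space of Borel probability measures is the carrier of the library's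
  \<^const>\<open>prob_algebra\<close>.\<close>

abbreviation borel_probs :: "'a::metric_space measure set" where
  "borel_probs \<equiv> space (prob_algebra borel)"

text \<open>When \<open>X\<close> is compact, the set of values is bounded (by the diameter of \<open>X\<close>) and contains \<open>0\<close>,
  so the real supremum is the true one.\<close>

definition kantorovich :: "'a::metric_space measure \<Rightarrow> 'a measure \<Rightarrow> real" where
  "kantorovich \<mu>1 \<mu>2 =
     (SUP \<phi> \<in> {\<phi>::'a \<Rightarrow> real. 1-lipschitz_on UNIV \<phi>}. (\<integral>x. \<phi> x \<partial>\<mu>1) - (\<integral>x. \<phi> x \<partial>\<mu>2))"

text \<open>The image of the uniform probability measure on \<open>{0, \<dots>, n - 1}\<close> under \<open>k \<mapsto> f\<^sup>k(x)\<close>; see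
  \<open>measure_empirical\<close> for the average of Dirac measures. The value for \<open>n = 0\<close> is irrelevant.\<close>

definition empirical :: "('a::metric_space \<Rightarrow> 'a) \<Rightarrow> nat \<Rightarrow> 'a \<Rightarrow> 'a measure" where
  "empirical f n x = distr (uniform_count_measure {..<n}) borel (\<lambda>k. (f ^^ k) x)"

lemma empirical_measurable:
  "(\<lambda>k. (f ^^ k) (x::'a::metric_space)) \<in> uniform_count_measure {..<n} \<rightarrow>\<^sub>M borel"
  by (auto simp: measurable_def space_uniform_count_measure sets_uniform_count_measure)

lemma empirical_in_borel_probs:
  assumes "n \<ge> 1"
  shows "empirical f n x \<in> borel_probs"
proof -
  interpret prob_space "uniform_count_measure {..<n}"
    using assms by (intro prob_space_uniform_count_measure) (auto simp: lessThan_empty_iff)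
  show ?thesis
    unfolding space_prob_algebra empirical_def
    using prob_space_distr[OF empirical_measurable] by simp
qed

lemma measure_empirical:
  assumes "n \<ge> 1" and A: "A \<in> sets borel"
  shows "measure (empirical f n x) A = (\<Sum>k<n. measure (return borel ((f ^^ k) x)) A) / n"
proof -
  have "measure (empirical f n x) A = measure (uniform_count_measure {..<n}) {k \<in> {..<n}. (f ^^ k) x \<in> A}"
    unfolding empirical_def
    by (subst measure_distr[OF empirical_measurable A])
      (auto intro!: arg_cong2[where f = measure] simp: space_uniform_count_measure)
  also have "\<dots> = card {k \<in> {..<n}. (f ^^ k) x \<in> A} / n"
    by (subst measure_uniform_count_measure) auto
  also have "real (card {k \<in> {..<n}. (f ^^ k) x \<in> A}) = (\<Sum>k<n. indicator A ((f ^^ k) x))"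
    by (simp add: indicator_def sum.If_cases Int_def)
  also have "\<dots> = (\<Sum>k<n. measure (return borel ((f ^^ k) x)) A)"
    using A by (simp add: measure_return)
  finally show ?thesis .
qed

text \<open>The distances are nonnegative, so integrals and upper limits are taken in \<^typ>\<open>ennreal\<close>.
  For compact \<open>X\<close>, continuous \<open>f\<close> and \<open>\<epsilon> > 0\<close> the space of probability measures is compact, so some \<open>N\<close>
  qualifies in both definitions and \<open>LEAST\<close> is the actual minimum; other values of \<open>\<epsilon>\<close> play no role.\<close>

definition emergence :: "'a::metric_space measure \<Rightarrow> ('a \<Rightarrow> 'a) \<Rightarrow> real \<Rightarrow> nat" where
  "emergence \<mu> f \<epsilon> = (LEAST N. N \<ge> 1 \<and>
     (\<exists>\<nu>::nat \<Rightarrow> 'a measure. (\<forall>i\<in>{1..N}. \<nu> i \<in> borel_probs) \<and>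
       limsup (\<lambda>n. \<integral>\<^sup>+x. ennreal (MIN i\<in>{1..N}. kantorovich (empirical f n x) (\<nu> i)) \<partial>\<mu>)
         < ennreal \<epsilon>))"

definition emergence2 :: "'a::metric_space measure \<Rightarrow> ('a \<Rightarrow> 'a) \<Rightarrow> real \<Rightarrow> nat" where
  "emergence2 \<mu> f \<epsilon> = (LEAST N. N \<ge> 1 \<and>
     (\<exists>\<nu>::nat \<Rightarrow> 'a measure. (\<forall>i\<in>{1..N}. \<nu> i \<in> borel_probs) \<and>
       (\<integral>\<^sup>+x. limsup (\<lambda>n. ennreal (MIN i\<in>{1..N}. kantorovich (empirical f n x) (\<nu> i))) \<partial>\<mu>)
         < ennreal \<epsilon>))"

definition upper_Dim :: "(real \<Rightarrow> real) \<Rightarrow> ereal" where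
  "upper_Dim \<phi> = Limsup (at_right 0) (\<lambda>\<epsilon>. ereal (\<bar>ln (\<phi> \<epsilon>)\<bar> / \<bar>ln \<epsilon>\<bar>))"

text \<open>Since \<open>ln 0 = 0\<close> for the library's real logarithm, the value \<open>log 0 = -\<infinity>\<close> is set explicitly.\<close>

definition log_abs_log :: "real \<Rightarrow> ereal" where
  "log_abs_log y = (if y = 1 then -\<infinity> else ereal (ln \<bar>ln y\<bar>))"

definition upper_Ord :: "(real \<Rightarrow> real) \<Rightarrow> ereal" where
  "upper_Ord \<phi> =
     (if \<forall>\<^sub>F \<epsilon> in at_right 0. \<phi> \<epsilon> = 1 then 0
      else Limsup (at_right 0) (\<lambda>\<epsilon>. log_abs_log (\<phi> \<epsilon>) / ereal \<bar>ln \<epsilon>\<bar>))"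

end

theory Submission
  imports Defs "HOL-Real_Asymp.Real_Asymp"
begin

text \<open>Both emergences of \<open>\<mu>\<close> are covering numbers: the least number of measures \<open>\<nu>\<^sub>i\<close> for which a cost,
  monotone in the functions \<open>min\<^sub>i d(e\<^sub>n(x), \<nu>\<^sub>i)\<close>, drops below \<open>\<epsilon>\<close>. The cost is built from integration
  against \<open>\<mu>\<close>, and integration against \<open>\<mu> = t \<mu>\<^sub>o + (1 - t) \<mu>\<^sub>1\<close> gives two comparisons. Putting together
  measures that serve \<open>\<mu>\<^sub>o\<close> and measures that serve \<open>\<mu>\<^sub>1\<close> gives measures that serve \<open>\<mu>\<close> at the same
  \<open>\<epsilon>\<close>, because a convex combination of numbers below \<open>\<epsilon>\<close> is below \<open>\<epsilon>\<close>; hence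
  \<open>E\<^sub>\<mu>(\<epsilon>) \<le> E\<^sub>o(\<epsilon>) + E\<^sub>1(\<epsilon>)\<close> (\<open>covers_append\<close>). Conversely \<open>t \<integral>g d\<mu>\<^sub>o \<le> \<integral>g d\<mu>\<close> for nonnegative \<open>g\<close>, so
  measures that serve \<open>\<mu>\<close> at \<open>t \<epsilon>\<close> serve \<open>\<mu>\<^sub>o\<close> at \<open>\<epsilon>\<close>; hence \<open>E\<^sub>o(\<epsilon>) \<le> E\<^sub>\<mu>(t \<epsilon>)\<close>, and likewise
  \<open>E\<^sub>1(\<epsilon>) \<le> E\<^sub>\<mu>((1 - t) \<epsilon>)\<close> (\<open>covers_rescale\<close>).

  Neither dimension nor order sees a factor \<open>2\<close> in front of the function or a constant factor in its
  argument, so the two comparisons give the two inequalities of the theorem. Indeed, for \<open>C \<ge> 0\<close> the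
  dimension (the order) of \<open>\<phi>\<close> is at most \<open>C\<close> iff for every \<open>c > C\<close> eventually \<open>\<phi>(\<epsilon>) \<le> \<epsilon>\<^sup>-\<^sup>c\<close>
  (\<open>\<phi>(\<epsilon>) \<le> exp(\<epsilon>\<^sup>-\<^sup>c)\<close>), and increasing \<open>c\<close> a little absorbs both factors. This is \<open>scale_eq_max\<close>,
  proved at once for the two scales.

  All this presupposes that the covering numbers are attained minima and not the value of \<open>LEAST\<close> at an
  unsatisfiable predicate. That follows from total boundedness of the space of probability measures in
  the Kantorovich distance (\<open>borel_probs_totally_bounded\<close>): cut \<open>X\<close> into finitely many cells of small
  diameter and round the masses of the cells.\<close>

section \<open>Growth scales\<close>

text \<open>A real threshold with a non-strict eventual bound; for the two scales such a bound becomes an explicit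
  upper bound on the function itself.\<close>

lemma Limsup_le_iff_real:
  fixes X :: "'a \<Rightarrow> ereal"
  shows "Limsup F X \<le> C \<longleftrightarrow> (\<forall>c. C < ereal c \<longrightarrow> (\<forall>\<^sub>F x in F. X x \<le> ereal c))"
proof
  assume "Limsup F X \<le> C"
  then show "\<forall>c. C < ereal c \<longrightarrow> (\<forall>\<^sub>F x in F. X x \<le> ereal c)"
    unfolding Limsup_le_iff by (meson eventually_mono less_imp_le)
next
  assume ev: "\<forall>c. C < ereal c \<longrightarrow> (\<forall>\<^sub>F x in F. X x \<le> ereal c)"
  show "Limsup F X \<le> C"
    unfolding Limsup_le_iff
  proof (intro allI impI)
    fix y assume "C < y"
    then obtain c where c: "C < ereal c" "ereal c < y"
      using ereal_dense2 by blast
    from ev c(1) have "\<forall>\<^sub>F x in F. X x \<le> ereal c"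
      by blast
    then show "\<forall>\<^sub>F x in F. X x < y"
      using c(2) by (auto elim: eventually_mono)
  qed
qed

lemma eventually_at_right_0_less_1: "\<forall>\<^sub>F \<epsilon> in at_right (0::real). 0 < \<epsilon> \<and> \<epsilon> < 1"
  using eventually_at_right_less[of "0::real"] eventually_at_rightI[of 0 1 "\<lambda>\<epsilon>. \<epsilon> < (1::real)"]
  by (auto intro: eventually_conj)

lemma eventually_at_right_0_scale:
  fixes s :: real
  assumes "0 < s" "\<forall>\<^sub>F \<epsilon> in at_right 0. P \<epsilon>"
  shows "\<forall>\<^sub>F \<epsilon> in at_right 0. P (s * \<epsilon>)"
  using assms filtermap_times_pos_at_right[OF assms(1), of 0]
  by (metis eventually_filtermap mult_zero_right)

lemma ln_ratio_le_iff:
  fixes \<epsilon> y c :: real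
  assumes "0 < \<epsilon>" "\<epsilon> < 1" "1 \<le> y"
  shows "\<bar>ln y\<bar> / \<bar>ln \<epsilon>\<bar> \<le> c \<longleftrightarrow> y \<le> \<epsilon> powr - c"
proof -
  define L :: real where "L = - ln \<epsilon>"
  have L: "0 < L" "\<bar>ln \<epsilon>\<bar> = L" "\<epsilon> powr - c = exp (c * L)"
    using assms ln_less_zero[of \<epsilon>] by (auto simp: L_def powr_def)
  have "\<bar>ln y\<bar> / L \<le> c \<longleftrightarrow> ln y \<le> c * L"
    using assms(3) L(1) by (simp add: divide_le_eq)
  also have "\<dots> \<longleftrightarrow> y \<le> exp (c * L)"
    using assms(3) by (metis exp_le_cancel_iff exp_ln less_le_trans zero_less_one)
  finally show ?thesis
    by (simp only: L)
qed

lemma log_abs_log_ratio_le_iff: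
  fixes \<epsilon> y c :: real
  assumes "0 < \<epsilon>" "\<epsilon> < 1" "1 \<le> y"
  shows "log_abs_log y / ereal \<bar>ln \<epsilon>\<bar> \<le> ereal c \<longleftrightarrow> y \<le> exp (\<epsilon> powr - c)"
proof (cases "y = 1")
  case True
  then show ?thesis
    using assms ln_less_zero[of \<epsilon>] by (simp add: log_abs_log_def)
next
  case False
  then have "0 < ln y"
    using assms by simp
  have "log_abs_log y / ereal \<bar>ln \<epsilon>\<bar> \<le> ereal c \<longleftrightarrow> ln (ln y) / \<bar>ln \<epsilon>\<bar> \<le> c"
    using False \<open>0 < ln y\<close> ln_less_zero[OF assms(1,2)] by (simp add: log_abs_log_def)
  also have "\<dots> \<longleftrightarrow> ln (ln y) \<le> - c * ln \<epsilon>"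
    using ln_less_zero[OF assms(1,2)] by (auto simp: field_simps)
  also have "\<dots> \<longleftrightarrow> ln y \<le> \<epsilon> powr - c"
    using \<open>0 < ln y\<close> assms(1) ln_le_cancel_iff[of "ln y" "\<epsilon> powr - c"] by (simp add: ln_powr)
  also have "\<dots> \<longleftrightarrow> y \<le> exp (\<epsilon> powr - c)"
    using assms(3) by (metis exp_le_cancel_iff exp_ln less_le_trans zero_less_one)
  finally show ?thesis .
qed

text \<open>The part of the behaviour of the two scales that the argument uses: an upper bound on \<open>Scl\<close> means
  domination by all larger members of a family \<open>\<Theta>\<^sub>c\<close>, and a larger index absorbs a factor \<open>2\<close>
  together with a rescaling of \<open>\<epsilon>\<close>. The functions are natural-valued because for real values just
  above \<open>1\<close> the order may be negative.\<close>

definition scale_gauge :: "((real \<Rightarrow> real) \<Rightarrow> ereal) \<Rightarrow> (real \<Rightarrow> real \<Rightarrow> real) \<Rightarrow> bool" where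
  "scale_gauge Scl \<Theta> \<longleftrightarrow>
     (\<forall>\<phi>::real \<Rightarrow> nat. (\<forall>\<^sub>F \<epsilon> in at_right 0. 1 \<le> \<phi> \<epsilon>) \<longrightarrow>
        0 \<le> Scl (\<lambda>\<epsilon>. real (\<phi> \<epsilon>)) \<and>
        (\<forall>C\<ge>0. Scl (\<lambda>\<epsilon>. real (\<phi> \<epsilon>)) \<le> C \<longleftrightarrow>
          (\<forall>c. C < ereal c \<longrightarrow> (\<forall>\<^sub>F \<epsilon> in at_right 0. real (\<phi> \<epsilon>) \<le> \<Theta> c \<epsilon>)))) \<and>
     (\<forall>c c' s. 0 < c \<longrightarrow> c < c' \<longrightarrow> 0 < s \<longrightarrow>
        (\<forall>\<^sub>F \<epsilon> in at_right 0. 2 * \<Theta> c (s * \<epsilon>) \<le> \<Theta> c' \<epsilon>))"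

text \<open>The quotient of the two sides is a constant times \<open>\<epsilon>\<^bsup>c' - c\<^esup>\<close>, which tends to \<open>0\<close>.\<close>

lemma powr_gap:
  assumes "c < c'" "0 < s"
  shows "\<forall>\<^sub>F \<epsilon> in at_right 0. K * (s * \<epsilon>) powr - c \<le> \<epsilon> powr - (c'::real)"
proof -
  have "((\<lambda>\<epsilon>. K * s powr - c * \<epsilon> powr (c' - c)) \<longlongrightarrow> K * s powr - c * 0) (at_right 0)"
  proof (intro tendsto_mult tendsto_const)
    show "((\<lambda>\<epsilon>. \<epsilon> powr (c' - c)) \<longlongrightarrow> 0) (at_right (0::real))"
      using assms(1) by real_asymp
  qed
  then have "\<forall>\<^sub>F \<epsilon> in at_right 0. K * s powr - c * \<epsilon> powr (c' - c) < 1"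
    by (rule order_tendstoD) simp
  then show ?thesis
    using eventually_at_right_less[of "0::real"]
  proof eventually_elim
    case (elim \<epsilon>)
    have "K * (s * \<epsilon>) powr - c = K * s powr - c * \<epsilon> powr (c' - c) * \<epsilon> powr - c'"
      using elim(2) assms(2) by (simp add: powr_mult mult.assoc flip: powr_add)
    also have "\<dots> \<le> 1 * \<epsilon> powr - c'"
      using elim(1) by (intro mult_right_mono) auto
    finally show ?case by simp
  qed
qed

lemma scale_gauge_Dim: "scale_gauge upper_Dim (\<lambda>c \<epsilon>. \<epsilon> powr - c)"
  unfolding scale_gauge_def
proof (intro conjI allI impI)
  fix \<phi> :: "real \<Rightarrow> nat" assume \<phi>: "\<forall>\<^sub>F \<epsilon> in at_right 0. 1 \<le> \<phi> \<epsilon>"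
  show "0 \<le> upper_Dim (\<lambda>\<epsilon>. real (\<phi> \<epsilon>))"
    unfolding upper_Dim_def by (rule le_Limsup) auto
  fix C :: ereal
  have "\<forall>\<^sub>F \<epsilon> in at_right 0. ereal (\<bar>ln (real (\<phi> \<epsilon>))\<bar> / \<bar>ln \<epsilon>\<bar>) \<le> ereal c \<longleftrightarrow> real (\<phi> \<epsilon>) \<le> \<epsilon> powr - c" for c
    using \<phi> eventually_at_right_0_less_1 by eventually_elim (use ln_ratio_le_iff in force)
  from eventually_subst[OF this] show "upper_Dim (\<lambda>\<epsilon>. real (\<phi> \<epsilon>)) \<le> C \<longleftrightarrow>
      (\<forall>c. C < ereal c \<longrightarrow> (\<forall>\<^sub>F \<epsilon> in at_right 0. real (\<phi> \<epsilon>) \<le> \<epsilon> powr - c))"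
    unfolding upper_Dim_def Limsup_le_iff_real by simp
next
  show "\<forall>\<^sub>F \<epsilon> in at_right 0. 2 * (s * \<epsilon>) powr - c \<le> \<epsilon> powr - c'" if "c < c'" "0 < s" for c c' s :: real
    using that by (rule powr_gap)
qed

text \<open>A negative order would force \<open>\<phi>(\<epsilon>) \<le> exp(\<epsilon>\<^bsup>a\<^esup>)\<close> with \<open>a > 0\<close>, hence \<open>\<phi>(\<epsilon>) < 2\<close> eventually. A
  natural number in \<open>[1, 2)\<close> is \<open>1\<close>, and for the constant \<open>1\<close> the order is \<open>0\<close> by convention.\<close>

lemma upper_Ord_nonneg:
  fixes \<phi> :: "real \<Rightarrow> nat"
  assumes "\<forall>\<^sub>F \<epsilon> in at_right 0. 1 \<le> \<phi> \<epsilon>"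
  shows "0 \<le> upper_Ord (\<lambda>\<epsilon>. real (\<phi> \<epsilon>))"
proof (cases "\<forall>\<^sub>F \<epsilon> in at_right 0. real (\<phi> \<epsilon>) = 1")
  case True
  then show ?thesis by (simp add: upper_Ord_def)
next
  case False
  let ?g = "\<lambda>\<epsilon>. log_abs_log (real (\<phi> \<epsilon>)) / ereal \<bar>ln \<epsilon>\<bar>"
  show ?thesis
  proof (rule ccontr)
    assume "\<not> ?thesis"
    then have "Limsup (at_right 0) ?g < 0"
      using False by (simp add: upper_Ord_def)
    then obtain c where c: "Limsup (at_right 0) ?g < ereal c" "ereal c < 0"
      using ereal_dense2 by blast
    have "((\<lambda>\<epsilon>. exp (\<epsilon> powr - c)) \<longlongrightarrow> exp 0) (at_right 0)"
    proof (intro tendsto_exp)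
      show "((\<lambda>\<epsilon>. \<epsilon> powr - c) \<longlongrightarrow> 0) (at_right 0)"
        using c(2) by real_asymp
    qed
    then have "\<forall>\<^sub>F \<epsilon> in at_right 0. exp (\<epsilon> powr - c) < 2"
      by (rule order_tendstoD) simp
    with Limsup_lessD[OF c(1)] assms eventually_at_right_0_less_1
    have "\<forall>\<^sub>F \<epsilon> in at_right 0. real (\<phi> \<epsilon>) = 1"
    proof eventually_elim
      case (elim \<epsilon>)
      then have "real (\<phi> \<epsilon>) \<le> exp (\<epsilon> powr - c)"
        using log_abs_log_ratio_le_iff[of \<epsilon> "real (\<phi> \<epsilon>)" c] by (simp only: less_imp_le real_of_nat_ge_one_iff)
      with elim have "real (\<phi> \<epsilon>) < 2"
        by simp
      with elim show ?case by simp
    qed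
    with False show False ..
  qed
qed

lemma scale_gauge_Ord: "scale_gauge upper_Ord (\<lambda>c \<epsilon>. exp (\<epsilon> powr - c))"
  unfolding scale_gauge_def
proof (intro conjI allI impI)
  fix \<phi> :: "real \<Rightarrow> nat" assume \<phi>: "\<forall>\<^sub>F \<epsilon> in at_right 0. 1 \<le> \<phi> \<epsilon>"
  show "0 \<le> upper_Ord (\<lambda>\<epsilon>. real (\<phi> \<epsilon>))"
    using \<phi> by (rule upper_Ord_nonneg)
  fix C :: ereal assume C: "0 \<le> C"
  show "upper_Ord (\<lambda>\<epsilon>. real (\<phi> \<epsilon>)) \<le> C \<longleftrightarrow>
      (\<forall>c. C < ereal c \<longrightarrow> (\<forall>\<^sub>F \<epsilon> in at_right 0. real (\<phi> \<epsilon>) \<le> exp (\<epsilon> powr - c)))"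
  proof (cases "\<forall>\<^sub>F \<epsilon> in at_right 0. real (\<phi> \<epsilon>) = 1")
    case True
    then have "\<forall>\<^sub>F \<epsilon> in at_right 0. real (\<phi> \<epsilon>) \<le> exp (\<epsilon> powr - c)" for c
      by (rule eventually_mono) simp
    with True C show ?thesis
      by (simp add: upper_Ord_def)
  next
    case False
    have "\<forall>\<^sub>F \<epsilon> in at_right 0. log_abs_log (real (\<phi> \<epsilon>)) / ereal \<bar>ln \<epsilon>\<bar> \<le> ereal c \<longleftrightarrow>
        real (\<phi> \<epsilon>) \<le> exp (\<epsilon> powr - c)" for c
      using \<phi> eventually_at_right_0_less_1
      by eventually_elim (use log_abs_log_ratio_le_iff in force)
    from eventually_subst[OF this] False show ?thesis
      unfolding upper_Ord_def by (simp add: Limsup_le_iff_real)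
  qed
next
  fix c c' s :: real assume "0 < c" "c < c'" "0 < s"
  have "\<forall>\<^sub>F \<epsilon> in at_right 0. 2 * (s * \<epsilon>) powr - c \<le> \<epsilon> powr - c'"
    using \<open>c < c'\<close> \<open>0 < s\<close> by (rule powr_gap)
  \<comment> \<open>The factor \<open>2 \<le> exp 1\<close> adds \<open>1\<close> to the exponent, and this is at most the exponent itself.\<close>
  moreover have "\<forall>\<^sub>F \<epsilon> in at_right 0. 1 \<le> (s * \<epsilon>) powr - c"
  proof (rule eventually_at_right_0_scale[OF \<open>0 < s\<close>])
    show "\<forall>\<^sub>F \<epsilon> in at_right 0. 1 \<le> \<epsilon> powr - c"
      using eventually_at_right_0_less_1
      by eventually_elim (use \<open>0 < c\<close> in \<open>simp add: powr_minus_divide powr_le1\<close>)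
  qed
  ultimately show "\<forall>\<^sub>F \<epsilon> in at_right 0. 2 * exp ((s * \<epsilon>) powr - c) \<le> exp (\<epsilon> powr - c')"
  proof eventually_elim
    case (elim \<epsilon>)
    have "2 * exp ((s * \<epsilon>) powr - c) \<le> exp 1 * exp ((s * \<epsilon>) powr - c)"
      using exp_ge_add_one_self[of 1] by (intro mult_right_mono) auto
    also have "\<dots> \<le> exp (\<epsilon> powr - c')"
      using elim by (simp flip: exp_add)
    finally show ?case .
  qed
qed

text \<open>Each inequality is tested at an arbitrary \<open>c\<close> above the bound, with an intermediate \<open>b\<close>: the hypotheses
  give domination by \<open>\<Theta>\<^sub>b\<close>, and the passage from \<open>b\<close> to \<open>c\<close> pays for the sum of two functions or for the
  rescaling.\<close>

lemma scale_eq_max: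
  fixes \<phi> \<phi>\<^sub>o \<phi>\<^sub>1 :: "real \<Rightarrow> nat"
  assumes gauge: "scale_gauge Scl \<Theta>" and s: "0 < s\<^sub>o" "0 < s\<^sub>1"
    and ge1: "\<And>\<epsilon>. 0 < \<epsilon> \<Longrightarrow> 1 \<le> \<phi> \<epsilon>" "\<And>\<epsilon>. 0 < \<epsilon> \<Longrightarrow> 1 \<le> \<phi>\<^sub>o \<epsilon>" "\<And>\<epsilon>. 0 < \<epsilon> \<Longrightarrow> 1 \<le> \<phi>\<^sub>1 \<epsilon>"
    and upper: "\<And>\<epsilon>. 0 < \<epsilon> \<Longrightarrow> \<phi> \<epsilon> \<le> \<phi>\<^sub>o \<epsilon> + \<phi>\<^sub>1 \<epsilon>"
    and lower: "\<And>\<epsilon>. 0 < \<epsilon> \<Longrightarrow> \<phi>\<^sub>o \<epsilon> \<le> \<phi> (s\<^sub>o * \<epsilon>)" "\<And>\<epsilon>. 0 < \<epsilon> \<Longrightarrow> \<phi>\<^sub>1 \<epsilon> \<le> \<phi> (s\<^sub>1 * \<epsilon>)"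
  shows "Scl (\<lambda>\<epsilon>. real (\<phi> \<epsilon>)) = max (Scl (\<lambda>\<epsilon>. real (\<phi>\<^sub>o \<epsilon>))) (Scl (\<lambda>\<epsilon>. real (\<phi>\<^sub>1 \<epsilon>)))"
proof -
  note pos = eventually_at_right_less[of "0::real"]
  have nonneg: "0 \<le> Scl (\<lambda>\<epsilon>. real (\<psi> \<epsilon>))" if "\<And>\<epsilon>. 0 < \<epsilon> \<Longrightarrow> 1 \<le> \<psi> \<epsilon>" for \<psi> :: "real \<Rightarrow> nat"
    using gauge eventually_mono[OF pos, of "\<lambda>\<epsilon>. 1 \<le> \<psi> \<epsilon>"] that unfolding scale_gauge_def by blast
  have le_iff: "Scl (\<lambda>\<epsilon>. real (\<psi> \<epsilon>)) \<le> C \<longleftrightarrow>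
      (\<forall>c. C < ereal c \<longrightarrow> (\<forall>\<^sub>F \<epsilon> in at_right 0. real (\<psi> \<epsilon>) \<le> \<Theta> c \<epsilon>))"
    if "\<And>\<epsilon>. 0 < \<epsilon> \<Longrightarrow> 1 \<le> \<psi> \<epsilon>" "0 \<le> C" for \<psi> :: "real \<Rightarrow> nat" and C
    using gauge eventually_mono[OF pos, of "\<lambda>\<epsilon>. 1 \<le> \<psi> \<epsilon>"] that unfolding scale_gauge_def by blast
  have gap: "\<forall>\<^sub>F \<epsilon> in at_right 0. 2 * \<Theta> c (s * \<epsilon>) \<le> \<Theta> c' \<epsilon>" if "0 < c" "c < c'" "0 < s" for c c' s
    using gauge that unfolding scale_gauge_def by blast
  have lower': "Scl (\<lambda>\<epsilon>. real (\<psi> \<epsilon>)) \<le> Scl (\<lambda>\<epsilon>. real (\<phi> \<epsilon>))"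
    if \<psi>: "\<And>\<epsilon>. 0 < \<epsilon> \<Longrightarrow> 1 \<le> \<psi> \<epsilon>" "\<And>\<epsilon>. 0 < \<epsilon> \<Longrightarrow> \<psi> \<epsilon> \<le> \<phi> (s * \<epsilon>)" and "0 < s" for \<psi> s
  proof (rule le_iff[of \<psi>, OF \<psi>(1) nonneg[of \<phi>, OF ge1(1)], THEN iffD2]; (intro allI impI)?)
    fix c assume "Scl (\<lambda>\<epsilon>. real (\<phi> \<epsilon>)) < ereal c"
    then obtain b where b: "Scl (\<lambda>\<epsilon>. real (\<phi> \<epsilon>)) < ereal b" "b < c"
      using ereal_dense2 by force
    have "0 < b"
      using order.strict_trans1[OF nonneg[of \<phi>, OF ge1(1)] b(1)] by simp
    have "\<forall>\<^sub>F \<epsilon> in at_right 0. real (\<phi> (s * \<epsilon>)) \<le> \<Theta> b (s * \<epsilon>)"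
    proof (rule eventually_at_right_0_scale[OF \<open>0 < s\<close>])
      show "\<forall>\<^sub>F \<epsilon> in at_right 0. real (\<phi> \<epsilon>) \<le> \<Theta> b \<epsilon>"
        using le_iff[of \<phi>, OF ge1(1) nonneg[of \<phi>, OF ge1(1)]] b(1) by blast
    qed
    with pos gap[OF \<open>0 < b\<close> b(2) \<open>0 < s\<close>] show "\<forall>\<^sub>F \<epsilon> in at_right 0. real (\<psi> \<epsilon>) \<le> \<Theta> c \<epsilon>"
    proof eventually_elim
      case (elim \<epsilon>)
      then show ?case
        using \<psi>(2)[OF elim(1)] by linarith
    qed
  qed
  have "Scl (\<lambda>\<epsilon>. real (\<phi> \<epsilon>)) \<le> max (Scl (\<lambda>\<epsilon>. real (\<phi>\<^sub>o \<epsilon>))) (Scl (\<lambda>\<epsilon>. real (\<phi>\<^sub>1 \<epsilon>)))" (is "_ \<le> ?m")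
  proof -
    have m: "0 \<le> ?m"
      using nonneg[of \<phi>\<^sub>o, OF ge1(2)] by (simp add: le_max_iff_disj)
    show ?thesis
    proof (rule le_iff[of \<phi>, OF ge1(1) m, THEN iffD2]; (intro allI impI)?)
      fix c assume "?m < ereal c"
      then obtain b where b: "?m < ereal b" "b < c"
        using ereal_dense2[of ?m "ereal c"] by auto
      have "0 < b"
        using order.strict_trans1[OF m b(1)] by simp
      have "\<forall>\<^sub>F \<epsilon> in at_right 0. real (\<phi>\<^sub>o \<epsilon>) \<le> \<Theta> b \<epsilon>" "\<forall>\<^sub>F \<epsilon> in at_right 0. real (\<phi>\<^sub>1 \<epsilon>) \<le> \<Theta> b \<epsilon>"
        using le_iff[of \<phi>\<^sub>o, OF ge1(2) m] le_iff[of \<phi>\<^sub>1, OF ge1(3) m] b(1) by auto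
      with pos gap[OF \<open>0 < b\<close> b(2) zero_less_one] show "\<forall>\<^sub>F \<epsilon> in at_right 0. real (\<phi> \<epsilon>) \<le> \<Theta> c \<epsilon>"
      proof eventually_elim
        case (elim \<epsilon>)
        then show ?case
          using upper[OF elim(1)] by simp
      qed
    qed
  qed
  moreover have "?m \<le> Scl (\<lambda>\<epsilon>. real (\<phi> \<epsilon>))"
    using lower'[OF ge1(2) lower(1) s(1)] lower'[OF ge1(3) lower(2) s(2)] by simp
  ultimately show ?thesis
    by (rule antisym)
qed

section \<open>Total boundedness of the space of probability measures\<close>

lemma kantorovich_le:
  assumes "\<And>\<phi>::'a::metric_space \<Rightarrow> real. 1-lipschitz_on UNIV \<phi> \<Longrightarrow> (\<integral>x. \<phi> x \<partial>\<mu>) - (\<integral>x. \<phi> x \<partial>\<nu>) \<le> e"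
  shows "kantorovich \<mu> \<nu> \<le> e"
  unfolding kantorovich_def
proof (rule cSUP_least)
  have "1-lipschitz_on UNIV (\<lambda>_::'a. 0::real)"
    by (auto simp: lipschitz_on_def)
  then show "{\<phi>::'a \<Rightarrow> real. 1-lipschitz_on UNIV \<phi>} \<noteq> {}"
    by blast
qed (use assms in auto)

text \<open>Since \<open>\<psi>\<close> is 1-Lipschitz, replacing it on each cell by its value at a point close to that cell
  moves it by at most \<open>d\<close>.\<close>

lemma integral_near_step_function:
  fixes \<psi> :: "'a::metric_space \<Rightarrow> real" and B :: "nat \<Rightarrow> 'a set"
  assumes \<mu>: "\<mu> \<in> borel_probs"
    and \<psi>: "1-lipschitz_on UNIV \<psi>" and bnd: "\<And>x. \<bar>\<psi> x\<bar> \<le> D"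
    and B: "\<And>j. B j \<in> sets borel" "disjoint_family B" "(\<Union>j<m. B j) = UNIV"
    and near: "\<And>j x. x \<in> B j \<Longrightarrow> dist x (p j) \<le> d"
  shows "\<bar>(\<integral>x. \<psi> x \<partial>\<mu>) - (\<Sum>j<m. \<psi> (p j) * measure \<mu> (B j))\<bar> \<le> d"
proof -
  define h where "h x = (\<Sum>j<m. \<psi> (p j) * indicator (B j) x)" for x
  interpret prob_space \<mu>
    using \<mu> by (simp add: space_prob_algebra)
  have sets: "sets \<mu> = sets borel"
    using \<mu> by (simp add: space_prob_algebra)
  have [simp]: "space \<mu> = UNIV"
    using sets_eq_imp_space_eq[OF sets] by simp
  have [measurable]: "\<psi> \<in> borel_measurable \<mu>"
    using \<psi> borel_measurable_continuous_onI[OF lipschitz_on_continuous_on[OF \<psi>]]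
    by (simp add: measurable_cong_sets[OF sets refl])
  have int_\<psi>: "integrable \<mu> \<psi>"
    by (rule integrable_const_bound[of _ D]) (use bnd in auto)
  have int_h: "integrable \<mu> h" and lint_h: "(\<integral>x. h x \<partial>\<mu>) = (\<Sum>j<m. \<psi> (p j) * measure \<mu> (B j))"
    unfolding h_def using B(1) sets by (auto simp: emeasure_eq_measure simp del: sum_mult_indicator)
  have close: "\<bar>\<psi> x - h x\<bar> \<le> d" for x
  proof -
    obtain j where j: "j < m" "x \<in> B j"
      using B(3) by blast
    have "x \<notin> B i" if "i \<noteq> j" for i
      using disjoint_family_onD[OF B(2) _ _ that] j(2) by auto
    then have "h x = (\<Sum>i<m. if i = j then \<psi> (p j) else 0)"
      unfolding h_def using j by (intro sum.cong) auto
    also have "\<dots> = \<psi> (p j)"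
      using j by simp
    finally have "\<bar>\<psi> x - h x\<bar> = dist (\<psi> x) (\<psi> (p j))"
      by (simp add: dist_real_def)
    also have "\<dots> \<le> dist x (p j)"
      using lipschitz_onD[OF \<psi>, of x "p j"] by simp
    finally show ?thesis
      using near[OF j(2)] by simp
  qed
  have "\<bar>(\<integral>x. \<psi> x \<partial>\<mu>) - (\<integral>x. h x \<partial>\<mu>)\<bar> = \<bar>\<integral>x. \<psi> x - h x \<partial>\<mu>\<bar>"
    using int_\<psi> int_h by simp
  also have "\<dots> \<le> (\<integral>x. \<bar>\<psi> x - h x\<bar> \<partial>\<mu>)"
    by (rule integral_abs_bound)
  also have "\<dots> \<le> (\<integral>x. d \<partial>\<mu>)"
    using int_\<psi> int_h close by (intro integral_mono) auto
  also have "\<dots> = d"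
    using prob_space by simp
  finally show ?thesis
    by (simp add: lint_h)
qed

lemma compact_fine_partition:
  assumes "compact (UNIV :: 'a::metric_space set)" "0 < d"
  obtains m and p :: "nat \<Rightarrow> 'a::metric_space" and B :: "nat \<Rightarrow> 'a::metric_space set"
  where "\<And>j. B j \<in> sets borel" "disjoint_family B" "(\<Union>j<m. B j) = UNIV"
    and "\<And>j x. x \<in> B j \<Longrightarrow> dist x (p j) \<le> d"
proof -
  have "UNIV \<subseteq> (\<Union>x\<in>UNIV. ball (x::'a) d)"
  proof
    fix x :: 'a
    have "x \<in> ball x d"
      using \<open>0 < d\<close> by simp
    then show "x \<in> (\<Union>x\<in>UNIV. ball x d)"
      by blast
  qed
  then obtain T where T: "finite T" "UNIV \<subseteq> (\<Union>x\<in>T. ball (x::'a) d)"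
    using compactE_image[OF assms(1), of UNIV "\<lambda>x. ball x d"] by (metis open_ball)
  obtain p :: "nat \<Rightarrow> 'a" where p: "bij_betw p {0..<card T} T"
    using ex_bij_betw_nat_finite[OF T(1)] by blast
  have "T = p ` {..<card T}"
    using bij_betw_imp_surj_on[OF p] by (simp add: lessThan_atLeast0)
  then have "UNIV \<subseteq> (\<Union>x\<in>p ` {..<card T}. ball x d)"
    using T(2) by simp
  then have cover: "(\<Union>j<card T. ball (p j) d) = UNIV"
    by auto
  show ?thesis
  proof (rule that)
    show "disjointed (\<lambda>j. ball (p j) d) j \<in> sets borel" for j
      by (simp add: disjointed_def)
    show "disjoint_family (disjointed (\<lambda>j. ball (p j) d))"
      by (rule disjoint_family_disjointed)
    show "(\<Union>j<card T. disjointed (\<lambda>j. ball (p j) d) j) = UNIV"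
      using cover by (simp add: lessThan_atLeast0 finite_UN_disjointed_eq)
    show "dist x (p j) \<le> d" if "x \<in> disjointed (\<lambda>j. ball (p j) d) j" for j x
      using that disjointed_subset[of "\<lambda>j. ball (p j) d" j] by (auto simp: dist_commute)
  qed
qed

text \<open>Subtracting a constant from a test function does not change its difference of integrals, so the test
  function may be taken to vanish at a base point; a 1-Lipschitz function with a zero is bounded by the
  diameter \<open>D\<close>. Its integrals against \<open>\<mu>\<close> and \<open>\<nu>\<close> are then determined by the cell masses up to \<open>d\<close>
  each.\<close>

lemma kantorovich_le_cell_masses:
  fixes B :: "nat \<Rightarrow> 'a::metric_space set"
  assumes \<mu>: "\<mu> \<in> borel_probs" and \<nu>: "\<nu> \<in> borel_probs"
    and D: "\<And>x y :: 'a. dist x y \<le> D"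
    and B: "\<And>j. B j \<in> sets borel" "disjoint_family B" "(\<Union>j<m. B j) = UNIV"
    and near: "\<And>j x. x \<in> B j \<Longrightarrow> dist x (p j) \<le> d"
  shows "kantorovich \<mu> \<nu> \<le> 2 * d + D * (\<Sum>j<m. \<bar>measure \<mu> (B j) - measure \<nu> (B j)\<bar>)"
proof (rule kantorovich_le)
  fix \<phi> :: "'a \<Rightarrow> real" assume \<phi>: "1-lipschitz_on UNIV \<phi>"
  \<comment> \<open>Any base point will do; \<open>undefined\<close> is one.\<close>
  define \<psi> where "\<psi> x = \<phi> x - \<phi> undefined" for x
  have \<psi>: "1-lipschitz_on UNIV \<psi>"
    using \<phi> by (auto simp: lipschitz_on_def \<psi>_def dist_real_def)
  have bnd: "\<bar>\<psi> x\<bar> \<le> D" for x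
    using lipschitz_onD[OF \<phi>, of x undefined] D[of x undefined] by (simp add: \<psi>_def dist_real_def)
  have shift: "(\<integral>x. \<psi> x \<partial>M) = (\<integral>x. \<phi> x \<partial>M) - \<phi> undefined" if "M \<in> borel_probs" for M
  proof -
    interpret prob_space M
      using that by (simp add: space_prob_algebra)
    have sets: "sets M = sets borel"
      using that by (simp add: space_prob_algebra)
    have [measurable]: "\<psi> \<in> borel_measurable M"
      using borel_measurable_continuous_onI[OF lipschitz_on_continuous_on[OF \<psi>]]
      by (simp add: measurable_cong_sets[OF sets refl])
    have "integrable M \<psi>"
      by (rule integrable_const_bound[of _ D]) (use bnd in auto)
    then have "(\<integral>x. \<psi> x + \<phi> undefined \<partial>M) = (\<integral>x. \<psi> x \<partial>M) + \<phi> undefined"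
      by (simp add: prob_space)
    then show ?thesis
      by (simp add: \<psi>_def)
  qed
  have step: "\<bar>(\<integral>x. \<psi> x \<partial>M) - (\<Sum>j<m. \<psi> (p j) * measure M (B j))\<bar> \<le> d" if "M \<in> borel_probs" for M
    by (rule integral_near_step_function[OF that \<psi> bnd B near])
  have "(\<Sum>j<m. \<psi> (p j) * measure \<mu> (B j)) - (\<Sum>j<m. \<psi> (p j) * measure \<nu> (B j))
      = (\<Sum>j<m. \<psi> (p j) * (measure \<mu> (B j) - measure \<nu> (B j)))"
    by (simp add: sum_subtractf right_diff_distrib)
  also have "\<dots> \<le> (\<Sum>j<m. D * \<bar>measure \<mu> (B j) - measure \<nu> (B j)\<bar>)"
  proof (rule sum_mono)
    fix j
    have "\<psi> (p j) * (measure \<mu> (B j) - measure \<nu> (B j)) \<le> \<bar>\<psi> (p j)\<bar> * \<bar>measure \<mu> (B j) - measure \<nu> (B j)\<bar>"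
      by (metis abs_ge_self abs_mult)
    also have "\<dots> \<le> D * \<bar>measure \<mu> (B j) - measure \<nu> (B j)\<bar>"
      using bnd by (intro mult_right_mono) auto
    finally show "\<psi> (p j) * (measure \<mu> (B j) - measure \<nu> (B j)) \<le> D * \<bar>measure \<mu> (B j) - measure \<nu> (B j)\<bar>" .
  qed
  finally have "(\<Sum>j<m. \<psi> (p j) * measure \<mu> (B j)) - (\<Sum>j<m. \<psi> (p j) * measure \<nu> (B j))
      \<le> D * (\<Sum>j<m. \<bar>measure \<mu> (B j) - measure \<nu> (B j)\<bar>)"
    by (simp add: sum_distrib_left)
  then show "(\<integral>x. \<phi> x \<partial>\<mu>) - (\<integral>x. \<phi> x \<partial>\<nu>) \<le> 2 * d + D * (\<Sum>j<m. \<bar>measure \<mu> (B j) - measure \<nu> (B j)\<bar>)"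
    using step[OF \<mu>] step[OF \<nu>] shift[OF \<mu>] shift[OF \<nu>] by linarith
qed

text \<open>Two measures whose cell masses agree after rounding down to multiples of \<open>1/K\<close> are within \<open>e\<close>, and only
  finitely many rounded mass vectors occur; one representative for each of them is an \<open>e\<close>-net.\<close>

lemma borel_probs_totally_bounded:
  assumes cpt: "compact (UNIV :: 'a::metric_space set)" and "0 < e"
  obtains T :: "'a::metric_space measure set" where "finite T" "T \<subseteq> borel_probs"
    and "\<And>\<mu>. \<mu> \<in> borel_probs \<Longrightarrow> \<exists>\<nu>\<in>T. kantorovich \<mu> \<nu> \<le> e"
proof -
  obtain m and p :: "nat \<Rightarrow> 'a" and B :: "nat \<Rightarrow> 'a set"
    where B: "\<And>j. B j \<in> sets borel" "disjoint_family B" "(\<Union>j<m. B j) = UNIV"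
      and near: "\<And>j x. x \<in> B j \<Longrightarrow> dist x (p j) \<le> e / 4"
    using compact_fine_partition[OF cpt, of "e / 4"] \<open>0 < e\<close>
    by (metis divide_pos_pos zero_less_numeral)
  obtain D where D: "\<And>x y :: 'a. dist x y \<le> D"
    using compact_imp_bounded[OF cpt] by (auto simp: bounded_two_points)
  \<comment> \<open>The masses of \<open>m\<close> cells, each known up to \<open>1/K\<close>, contribute at most \<open>D m / K < e / 2\<close>.\<close>
  obtain K :: nat where K: "2 * D * m / e < K"
    using reals_Archimedean2 by blast
  have "0 \<le> D"
    using D[of undefined undefined] by simp
  then have "0 < real K"
    using K \<open>0 < e\<close> by (smt (verit) divide_nonneg_pos mult_nonneg_nonneg of_nat_0_le_iff)
  define key :: "'a measure \<Rightarrow> nat \<Rightarrow> nat"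
    where "key \<mu> = (\<lambda>j\<in>{..<m}. nat \<lfloor>K * measure \<mu> (B j)\<rfloor>)" for \<mu>
  have "key \<mu> \<in> {..<m} \<rightarrow>\<^sub>E {..K}" if "\<mu> \<in> borel_probs" for \<mu>
  proof -
    interpret prob_space \<mu>
      using that by (simp add: space_prob_algebra)
    have "nat \<lfloor>K * measure \<mu> (B j)\<rfloor> \<le> K" for j
    proof -
      have "K * measure \<mu> (B j) \<le> K"
        by (simp add: mult_left_le)
      then show ?thesis by linarith
    qed
    then show ?thesis
      by (auto simp: key_def)
  qed
  then have "key ` borel_probs \<subseteq> {..<m} \<rightarrow>\<^sub>E {..K}"
    by blast
  then have fin: "finite (key ` borel_probs)"
    by (rule finite_subset) (auto intro: finite_PiE)
  have close: "kantorovich \<mu> \<nu> \<le> e" if \<mu>: "\<mu> \<in> borel_probs" and \<nu>: "\<nu> \<in> borel_probs" and eq: "key \<mu> = key \<nu>" for \<mu> \<nu>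
  proof -
    have "\<bar>measure \<mu> (B j) - measure \<nu> (B j)\<bar> \<le> 1 / K" if "j < m" for j
    proof -
      have "nat \<lfloor>K * measure \<mu> (B j)\<rfloor> = nat \<lfloor>K * measure \<nu> (B j)\<rfloor>"
        using fun_cong[OF eq, of j] that by (simp add: key_def)
      then have "\<lfloor>K * measure \<mu> (B j)\<rfloor> = \<lfloor>K * measure \<nu> (B j)\<rfloor>"
        by (simp add: eq_nat_nat_iff)
      then have "\<bar>K * measure \<mu> (B j) - K * measure \<nu> (B j)\<bar> \<le> 1"
        by linarith
      also have "K * measure \<mu> (B j) - K * measure \<nu> (B j) = K * (measure \<mu> (B j) - measure \<nu> (B j))"
        by (simp add: algebra_simps)
      finally show ?thesis
        using \<open>0 < real K\<close> by (simp only: abs_mult abs_of_nat) (simp add: field_simps)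
    qed
    then have "(\<Sum>j<m. \<bar>measure \<mu> (B j) - measure \<nu> (B j)\<bar>) \<le> (\<Sum>j<m. 1 / K)"
      by (intro sum_mono) auto
    then have "D * (\<Sum>j<m. \<bar>measure \<mu> (B j) - measure \<nu> (B j)\<bar>) \<le> D * (m / K)"
      using \<open>0 \<le> D\<close> by (intro mult_left_mono) auto
    also have "\<dots> \<le> e / 2"
      using K \<open>0 < e\<close> \<open>0 < real K\<close> by (simp add: field_simps)
    finally show ?thesis
      using kantorovich_le_cell_masses[where B = B and p = p, OF \<mu> \<nu> D B near] by simp
  qed
  define T where "T = inv_into borel_probs key ` (key ` borel_probs)"
  show ?thesis
  proof
    show "finite T"
      unfolding T_def using fin by simp
    show "T \<subseteq> borel_probs"
      unfolding T_def by (auto intro: inv_into_into)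
    show "\<exists>\<nu>\<in>T. kantorovich \<mu> \<nu> \<le> e" if \<mu>: "\<mu> \<in> borel_probs" for \<mu>
    proof
      let ?\<nu> = "inv_into borel_probs key (key \<mu>)"
      have "key \<mu> \<in> key ` borel_probs"
        using \<mu> by (rule imageI)
      then show "?\<nu> \<in> T"
        unfolding T_def by (rule imageI)
      show "kantorovich \<mu> ?\<nu> \<le> e"
        using \<open>key \<mu> \<in> key ` borel_probs\<close>
        by (intro close[OF \<mu>] inv_into_into) (auto intro: f_inv_into_f[symmetric])
    qed
  qed
qed

section \<open>Covering numbers of a cost\<close>

text \<open>The two emergences differ only in the order of integral and upper limit, and depend on the measure only
  through the integral. Both are the following number for a suitable cost \<open>C\<close>.\<close>

definition covers :: "((nat \<Rightarrow> 'a::metric_space \<Rightarrow> ennreal) \<Rightarrow> ennreal) \<Rightarrow> ('a \<Rightarrow> 'a) \<Rightarrow> real \<Rightarrow> nat \<Rightarrow> bool" where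
  "covers C f \<epsilon> N \<longleftrightarrow> N \<ge> 1 \<and>
     (\<exists>\<nu>::nat \<Rightarrow> 'a measure. (\<forall>i\<in>{1..N}. \<nu> i \<in> borel_probs) \<and>
       C (\<lambda>n x. ennreal (MIN i\<in>{1..N}. kantorovich (empirical f n x) (\<nu> i))) < ennreal \<epsilon>)"

definition covering_number :: "((nat \<Rightarrow> 'a::metric_space \<Rightarrow> ennreal) \<Rightarrow> ennreal) \<Rightarrow> ('a \<Rightarrow> 'a) \<Rightarrow> real \<Rightarrow> nat" where
  "covering_number C f \<epsilon> = (LEAST N. covers C f \<epsilon> N)"

text \<open>The net works uniformly in \<open>x\<close> and in \<open>n \<ge> 1\<close>. The empirical measure of length \<open>0\<close> is not a probability
  measure, so the hypothesis on \<open>C\<close> asks for a bound on \<open>g n\<close> only from \<open>n = 1\<close> on.\<close>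

lemma ex_covers:
  fixes C :: "(nat \<Rightarrow> 'a::metric_space \<Rightarrow> ennreal) \<Rightarrow> ennreal"
  assumes cpt: "compact (UNIV :: 'a set)" and "0 < \<epsilon>"
    and C: "\<And>g d. (\<And>n x. n \<ge> 1 \<Longrightarrow> g n x \<le> d) \<Longrightarrow> C g \<le> d"
  shows "\<exists>N. covers C f \<epsilon> N"
proof -
  obtain T :: "'a measure set" where T: "finite T" "T \<subseteq> borel_probs"
    and net: "\<And>\<mu>. \<mu> \<in> borel_probs \<Longrightarrow> \<exists>\<nu>\<in>T. kantorovich \<mu> \<nu> \<le> \<epsilon> / 2"
    using borel_probs_totally_bounded[OF cpt, of "\<epsilon> / 2"] \<open>0 < \<epsilon>\<close> by auto
  obtain \<nu> :: "nat \<Rightarrow> 'a measure" where \<nu>: "bij_betw \<nu> {1..card T} T"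
    using ex_bij_betw_nat_finite_1[OF T(1)] by blast
  have "T \<noteq> {}"
    using net[OF empirical_in_borel_probs[of 1]] by blast
  then have card: "1 \<le> card T"
    using T(1) by (simp add: Suc_le_eq card_gt_0_iff)
  have "ennreal (MIN i\<in>{1..card T}. kantorovich (empirical f n x) (\<nu> i)) \<le> ennreal (\<epsilon> / 2)"
    if n: "n \<ge> 1" for n x
  proof -
    obtain i where "i \<in> {1..card T}" "kantorovich (empirical f n x) (\<nu> i) \<le> \<epsilon> / 2"
      using net[OF empirical_in_borel_probs[OF n]] \<nu> by (metis bij_betw_imp_surj_on imageE)
    then show ?thesis
      by (intro ennreal_leI order_trans[OF Min_le]) auto
  qed
  then have "C (\<lambda>n x. ennreal (MIN i\<in>{1..card T}. kantorovich (empirical f n x) (\<nu> i))) \<le> ennreal (\<epsilon> / 2)"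
    by (rule C)
  also have "\<dots> < ennreal \<epsilon>"
    using \<open>0 < \<epsilon>\<close> by (simp add: ennreal_less_iff)
  finally have "covers C f \<epsilon> (card T)"
    unfolding covers_def using card \<nu> T(2) by (auto simp: bij_betw_def intro!: exI[of _ \<nu>])
  then show ?thesis ..
qed

text \<open>A minimum over the concatenated family is below both separate minima.\<close>

lemma covers_append:
  assumes o: "covers C\<^sub>o f \<epsilon> N\<^sub>o" and 1: "covers C\<^sub>1 f \<epsilon> N\<^sub>1"
    and C: "\<And>g g\<^sub>o g\<^sub>1. (\<And>n x. g n x \<le> g\<^sub>o n x) \<Longrightarrow> (\<And>n x. g n x \<le> g\<^sub>1 n x) \<Longrightarrow>
        C\<^sub>o g\<^sub>o < ennreal \<epsilon> \<Longrightarrow> C\<^sub>1 g\<^sub>1 < ennreal \<epsilon> \<Longrightarrow> C g < ennreal \<epsilon>"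
  shows "covers C f \<epsilon> (N\<^sub>o + N\<^sub>1)"
proof -
  obtain \<nu>\<^sub>o where \<nu>o: "N\<^sub>o \<ge> 1" "\<And>i. i \<in> {1..N\<^sub>o} \<Longrightarrow> \<nu>\<^sub>o i \<in> borel_probs"
      "C\<^sub>o (\<lambda>n x. ennreal (MIN i\<in>{1..N\<^sub>o}. kantorovich (empirical f n x) (\<nu>\<^sub>o i))) < ennreal \<epsilon>"
    using o unfolding covers_def by blast
  obtain \<nu>\<^sub>1 where \<nu>1: "N\<^sub>1 \<ge> 1" "\<And>i. i \<in> {1..N\<^sub>1} \<Longrightarrow> \<nu>\<^sub>1 i \<in> borel_probs"
      "C\<^sub>1 (\<lambda>n x. ennreal (MIN i\<in>{1..N\<^sub>1}. kantorovich (empirical f n x) (\<nu>\<^sub>1 i))) < ennreal \<epsilon>"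
    using 1 unfolding covers_def by blast
  define \<nu> where "\<nu> i = (if i \<le> N\<^sub>o then \<nu>\<^sub>o i else \<nu>\<^sub>1 (i - N\<^sub>o))" for i
  have le_o: "(MIN i\<in>{1..N\<^sub>o + N\<^sub>1}. F (\<nu> i)) \<le> (MIN i\<in>{1..N\<^sub>o}. F (\<nu>\<^sub>o i))" for F :: "_ \<Rightarrow> real"
  proof (rule Min_antimono)
    show "(\<lambda>i. F (\<nu>\<^sub>o i)) ` {1..N\<^sub>o} \<subseteq> (\<lambda>i. F (\<nu> i)) ` {1..N\<^sub>o + N\<^sub>1}"
      unfolding \<nu>_def by (force intro!: image_eqI)
  qed (use \<nu>o(1) in auto)
  have le_1: "(MIN i\<in>{1..N\<^sub>o + N\<^sub>1}. F (\<nu> i)) \<le> (MIN i\<in>{1..N\<^sub>1}. F (\<nu>\<^sub>1 i))" for F :: "_ \<Rightarrow> real"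
  proof (rule Min_antimono)
    have "F (\<nu>\<^sub>1 i) = F (\<nu> (N\<^sub>o + i)) \<and> N\<^sub>o + i \<in> {1..N\<^sub>o + N\<^sub>1}" if "i \<in> {1..N\<^sub>1}" for i
      using that by (auto simp: \<nu>_def)
    then show "(\<lambda>i. F (\<nu>\<^sub>1 i)) ` {1..N\<^sub>1} \<subseteq> (\<lambda>i. F (\<nu> i)) ` {1..N\<^sub>o + N\<^sub>1}"
      by blast
  qed (use \<nu>1(1) in auto)
  have "\<nu> i \<in> borel_probs" if "i \<in> {1..N\<^sub>o + N\<^sub>1}" for i
    using that \<nu>o(2)[of i] \<nu>1(2)[of "i - N\<^sub>o"]
    by (cases "i \<le> N\<^sub>o") (simp_all add: \<nu>_def Suc_le_eq)
  moreover have "C (\<lambda>n x. ennreal (MIN i\<in>{1..N\<^sub>o + N\<^sub>1}. kantorovich (empirical f n x) (\<nu> i))) < ennreal \<epsilon>"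
    by (rule C[OF _ _ \<nu>o(3) \<nu>1(3)]; intro ennreal_leI le_o le_1)
  ultimately show ?thesis
    unfolding covers_def using \<nu>o(1) by (auto intro!: exI[of _ \<nu>])
qed

lemma covers_rescale:
  assumes "covers C f (s * \<epsilon>) N"
    and "\<And>g. C g < ennreal (s * \<epsilon>) \<Longrightarrow> C' g < ennreal \<epsilon>"
  shows "covers C' f \<epsilon> N"
  using assms unfolding covers_def by blast

lemma covers_covering_number:
  assumes "\<exists>N. covers C f \<epsilon> N"
  shows "covers C f \<epsilon> (covering_number C f \<epsilon>)"
  unfolding covering_number_def using assms by (rule LeastI_ex)

lemma covering_number_le: "covers C f \<epsilon> N \<Longrightarrow> covering_number C f \<epsilon> \<le> N"
  unfolding covering_number_def by (rule Least_le)

text \<open>The hypotheses \<open>upper\<close> and \<open>lower\<close> say what remains, for a cost, of the relation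
  \<open>C = t C\<^sub>o + (1 - t) C\<^sub>1\<close>; they hold for both costs, although an upper limit of sums is only subadditive.\<close>

lemma scale_covering_number_eq_max:
  fixes f :: "'a::metric_space \<Rightarrow> 'a" and C C\<^sub>o C\<^sub>1 :: "(nat \<Rightarrow> 'a \<Rightarrow> ennreal) \<Rightarrow> ennreal"
  assumes cpt: "compact (UNIV :: 'a set)" and gauge: "scale_gauge Scl \<Theta>" and t: "0 < t" "t < 1"
    and bound: "\<And>K g d. K \<in> {C, C\<^sub>o, C\<^sub>1} \<Longrightarrow> (\<And>n x. n \<ge> 1 \<Longrightarrow> g n x \<le> d) \<Longrightarrow> K g \<le> d"
    and mono: "\<And>K g h. K \<in> {C\<^sub>o, C\<^sub>1} \<Longrightarrow> (\<And>n x. g n x \<le> h n x) \<Longrightarrow> K g \<le> K h"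
    and upper: "\<And>g e. C\<^sub>o g < e \<Longrightarrow> C\<^sub>1 g < e \<Longrightarrow> C g < e"
    and lower: "\<And>g \<epsilon>. C g < ennreal (t * \<epsilon>) \<Longrightarrow> C\<^sub>o g < ennreal \<epsilon>"
      "\<And>g \<epsilon>. C g < ennreal ((1 - t) * \<epsilon>) \<Longrightarrow> C\<^sub>1 g < ennreal \<epsilon>"
  shows "Scl (\<lambda>\<epsilon>. real (covering_number C f \<epsilon>)) =
    max (Scl (\<lambda>\<epsilon>. real (covering_number C\<^sub>o f \<epsilon>))) (Scl (\<lambda>\<epsilon>. real (covering_number C\<^sub>1 f \<epsilon>)))"
proof (rule scale_eq_max[OF gauge, of t "1 - t"])
  have attained: "covers K f \<epsilon> (covering_number K f \<epsilon>)" if "K \<in> {C, C\<^sub>o, C\<^sub>1}" "0 < \<epsilon>" for K \<epsilon>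
    by (intro covers_covering_number ex_covers[OF cpt that(2)] bound[OF that(1)])
  show "1 \<le> covering_number C f \<epsilon>" "1 \<le> covering_number C\<^sub>o f \<epsilon>" "1 \<le> covering_number C\<^sub>1 f \<epsilon>"
    if "0 < \<epsilon>" for \<epsilon>
    using attained[OF _ that] unfolding covers_def by auto
  show "covering_number C f \<epsilon> \<le> covering_number C\<^sub>o f \<epsilon> + covering_number C\<^sub>1 f \<epsilon>" if "0 < \<epsilon>" for \<epsilon>
  proof (rule covering_number_le[OF covers_append[OF attained attained]])
    fix g g\<^sub>o g\<^sub>1 :: "nat \<Rightarrow> 'a \<Rightarrow> ennreal"
    assume le: "\<And>n x. g n x \<le> g\<^sub>o n x" "\<And>n x. g n x \<le> g\<^sub>1 n x"
      and less: "C\<^sub>o g\<^sub>o < ennreal \<epsilon>" "C\<^sub>1 g\<^sub>1 < ennreal \<epsilon>"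
    have "C\<^sub>o g < ennreal \<epsilon>"
      by (rule le_less_trans[OF mono[of C\<^sub>o g g\<^sub>o] less(1)]) (simp_all add: le)
    moreover have "C\<^sub>1 g < ennreal \<epsilon>"
      by (rule le_less_trans[OF mono[of C\<^sub>1 g g\<^sub>1] less(2)]) (simp_all add: le)
    ultimately show "C g < ennreal \<epsilon>"
      by (rule upper)
  qed (use that in auto)
  show "covering_number C\<^sub>o f \<epsilon> \<le> covering_number C f (t * \<epsilon>)" if "0 < \<epsilon>" for \<epsilon>
    by (rule covering_number_le[OF covers_rescale[OF attained lower(1)]]) (simp_all add: t that)
  show "covering_number C\<^sub>1 f \<epsilon> \<le> covering_number C f ((1 - t) * \<epsilon>)" if "0 < \<epsilon>" for \<epsilon>
    by (rule covering_number_le[OF covers_rescale[OF attained lower(2)]]) (simp_all add: t that)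
qed (use t in auto)

section \<open>Integration against a mixture of measures\<close>

abbreviation limsup_integral :: "'a measure \<Rightarrow> (nat \<Rightarrow> 'a \<Rightarrow> ennreal) \<Rightarrow> ennreal" where
  "limsup_integral \<mu> g \<equiv> limsup (\<lambda>n. \<integral>\<^sup>+x. g n x \<partial>\<mu>)"

abbreviation integral_limsup :: "'a measure \<Rightarrow> (nat \<Rightarrow> 'a \<Rightarrow> ennreal) \<Rightarrow> ennreal" where
  "integral_limsup \<mu> g \<equiv> \<integral>\<^sup>+x. limsup (\<lambda>n. g n x) \<partial>\<mu>"

lemma emergence_eq: "emergence \<mu> f = covering_number (limsup_integral \<mu>) f"
  by (simp add: fun_eq_iff emergence_def covering_number_def covers_def)

lemma emergence2_eq: "emergence2 \<mu> f = covering_number (integral_limsup \<mu>) f"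
  by (simp add: fun_eq_iff emergence2_def covering_number_def covers_def)

text \<open>The integral of an arbitrary nonnegative function is the supremum of the integrals of the simple
  functions below it, and the integral of a simple function is linear in the measure. Arguing through
  simple functions covers all integrands, measurable or not.\<close>

lemma nn_integral_mixture_le:
  assumes sets: "sets N = sets M" "sets P = sets M"
    and em: "\<And>A. A \<in> sets M \<Longrightarrow> emeasure M A \<le> a * emeasure N A + b * emeasure P A"
  shows "(\<integral>\<^sup>+x. g x \<partial>M) \<le> a * (\<integral>\<^sup>+x. g x \<partial>N) + b * (\<integral>\<^sup>+x. g x \<partial>P)"
  unfolding nn_integral_def[of M]
proof (rule SUP_least, safe)
  fix s assume s: "simple_function M s" "s \<le> g"
  have sp: "space N = space M" "space P = space M"
    using sets by (auto dest: sets_eq_imp_space_eq)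
  have s': "simple_function N s" "simple_function P s"
    using s(1) sets sp by (auto simp: simple_function_def)
  have "integral\<^sup>S M s \<le> (\<Sum>y\<in>s ` space M. y * (a * emeasure N (s -` {y} \<inter> space M) + b * emeasure P (s -` {y} \<inter> space M)))"
    unfolding simple_integral_def
    using s(1) by (intro sum_mono mult_left_mono em) (auto intro: simple_functionD)
  also have "\<dots> = a * integral\<^sup>S N s + b * integral\<^sup>S P s"
    by (simp add: simple_integral_def sp sum_distrib_left sum.distrib algebra_simps)
  also have "\<dots> \<le> a * (\<integral>\<^sup>+x. g x \<partial>N) + b * (\<integral>\<^sup>+x. g x \<partial>P)"
    using s(2) s' by (intro add_mono mult_left_mono) (auto simp: nn_integral_def intro!: SUP_upper)
  finally show "integral\<^sup>S M s \<le> a * (\<integral>\<^sup>+x. g x \<partial>N) + b * (\<integral>\<^sup>+x. g x \<partial>P)" .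
qed

lemma nn_integral_scaled_le:
  assumes sets: "sets N = sets M"
    and em: "\<And>A. A \<in> sets M \<Longrightarrow> ennreal s * emeasure N A \<le> emeasure M A" and "0 < s"
  shows "ennreal s * (\<integral>\<^sup>+x. g x \<partial>N) \<le> (\<integral>\<^sup>+x. g x \<partial>M)"
proof -
  have inv: "ennreal (1 / s) * ennreal s = 1"
    using \<open>0 < s\<close> by (simp flip: ennreal_mult)
  \<comment> \<open>A mixture with the weights \<open>1 / s\<close> and \<open>0\<close>.\<close>
  have "emeasure N A \<le> ennreal (1 / s) * emeasure M A + 0 * emeasure M A" if "A \<in> sets N" for A
    using mult_left_mono[OF em, of A "ennreal (1 / s)"] that sets inv
    by (simp add: mult.assoc[symmetric])
  then have "(\<integral>\<^sup>+x. g x \<partial>N) \<le> ennreal (1 / s) * (\<integral>\<^sup>+x. g x \<partial>M) + 0 * (\<integral>\<^sup>+x. g x \<partial>M)"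
    using sets by (intro nn_integral_mixture_le) auto
  then have "ennreal s * (\<integral>\<^sup>+x. g x \<partial>N) \<le> ennreal s * (ennreal (1 / s) * (\<integral>\<^sup>+x. g x \<partial>M))"
    by (intro mult_left_mono) auto
  then show ?thesis
    using inv by (metis mult.assoc mult.commute mult_1)
qed

lemma convex_combination_ennreal_le:
  assumes "0 \<le> t" "t \<le> 1" "u \<le> d" "v \<le> (d::ennreal)"
  shows "ennreal t * u + ennreal (1 - t) * v \<le> d"
proof -
  have "ennreal t * u + ennreal (1 - t) * v \<le> ennreal t * d + ennreal (1 - t) * d"
    using assms by (intro add_mono mult_left_mono) auto
  also have "\<dots> = d"
    using assms by (simp flip: distrib_right ennreal_plus)
  finally show ?thesis .
qed

lemma less_if_scaled_less:
  assumes "0 < s" "ennreal s * u < ennreal (s * \<epsilon>)"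
  shows "u < ennreal \<epsilon>"
proof (rule ccontr)
  assume "\<not> ?thesis"
  then have "ennreal s * ennreal \<epsilon> \<le> ennreal s * u"
    by (intro mult_left_mono) auto
  also have "ennreal s * ennreal \<epsilon> = ennreal (s * \<epsilon>)"
    using assms(1) by (simp add: ennreal_mult')
  finally show False
    using assms(2) by (simp add: leD)
qed

lemma limsup_integral_le:
  assumes "\<mu> \<in> borel_probs" "\<And>n x. n \<ge> 1 \<Longrightarrow> g n x \<le> d"
  shows "limsup_integral \<mu> g \<le> d"
proof (rule Limsup_bounded)
  interpret prob_space \<mu>
    using assms(1) by (simp add: space_prob_algebra)
  show "\<forall>\<^sub>F n in sequentially. (\<integral>\<^sup>+x. g n x \<partial>\<mu>) \<le> d"
    using eventually_ge_at_top[of 1]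
  proof eventually_elim
    case (elim n)
    have "(\<integral>\<^sup>+x. g n x \<partial>\<mu>) \<le> (\<integral>\<^sup>+x. d \<partial>\<mu>)"
      using assms(2)[OF elim] by (intro nn_integral_mono)
    then show ?case
      by (simp add: emeasure_space_1)
  qed
qed

lemma integral_limsup_le:
  assumes "\<mu> \<in> borel_probs" "\<And>n x. n \<ge> 1 \<Longrightarrow> g n x \<le> d"
  shows "integral_limsup \<mu> g \<le> d"
proof -
  interpret prob_space \<mu>
    using assms(1) by (simp add: space_prob_algebra)
  have "limsup (\<lambda>n. g n x) \<le> d" for x
    using eventually_mono[OF eventually_ge_at_top[of 1] assms(2)] by (intro Limsup_bounded)
  then have "integral_limsup \<mu> g \<le> (\<integral>\<^sup>+x. d \<partial>\<mu>)"
    by (intro nn_integral_mono)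
  then show ?thesis
    by (simp add: emeasure_space_1)
qed

text \<open>A number strictly between the upper limit and \<open>s \<epsilon>\<close> turns the strict inequality of limits into an
  eventual bound on the terms, which can be divided by \<open>s\<close>.\<close>

lemma limsup_less_if_scaled_less:
  assumes "0 < s" "\<And>n. ennreal s * v n \<le> u n" "limsup u < ennreal (s * \<epsilon>)"
  shows "limsup v < ennreal \<epsilon>"
proof -
  obtain d where d: "limsup u < d" "d < ennreal (s * \<epsilon>)"
    using dense[OF assms(3)] by blast
  define d' where "d' = ennreal (1 / s) * d"
  have "ennreal s * ennreal (1 / s) = 1"
    using assms(1) by (simp flip: ennreal_mult)
  then have d': "ennreal s * d' = d"
    unfolding d'_def by (metis mult.assoc mult_1)
  have "\<forall>\<^sub>F n in sequentially. v n \<le> d'"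
    using Limsup_lessD[OF d(1)]
  proof eventually_elim
    case (elim n)
    have "ennreal (1 / s) * (ennreal s * v n) \<le> d'"
      unfolding d'_def using elim assms(2)[of n] by (intro mult_left_mono) auto
    then show ?case
      using \<open>ennreal s * ennreal (1 / s) = 1\<close> by (metis mult.assoc mult.commute mult_1)
  qed
  then have "limsup v \<le> d'"
    by (rule Limsup_bounded)
  also have "d' < ennreal \<epsilon>"
    using less_if_scaled_less[OF assms(1)] d(2) d' by simp
  finally show ?thesis .
qed

section \<open>The emergence of a mixture\<close>

theorem theorem4p1:
  fixes f :: "'a::metric_space \<Rightarrow> 'a"
    and \<mu> \<mu>\<^sub>o \<mu>\<^sub>1 :: "'a measure"
    and t :: real
    and Scl :: "(real \<Rightarrow> real) \<Rightarrow> ereal"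
  assumes "compact (UNIV :: 'a set)"
    and "continuous_on UNIV f"
    and "\<mu> \<in> borel_probs" "\<mu>\<^sub>o \<in> borel_probs" "\<mu>\<^sub>1 \<in> borel_probs"
    and "0 < t" "t < 1"
    and "\<And>A. A \<in> sets borel \<Longrightarrow> measure \<mu> A = t * measure \<mu>\<^sub>o A + (1 - t) * measure \<mu>\<^sub>1 A"
    and "Scl \<in> {upper_Dim, upper_Ord}"
  shows "Scl (\<lambda>\<epsilon>. real (emergence \<mu> f \<epsilon>)) =
           max (Scl (\<lambda>\<epsilon>. real (emergence \<mu>\<^sub>o f \<epsilon>))) (Scl (\<lambda>\<epsilon>. real (emergence \<mu>\<^sub>1 f \<epsilon>)))
       \<and> Scl (\<lambda>\<epsilon>. real (emergence2 \<mu> f \<epsilon>)) =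
           max (Scl (\<lambda>\<epsilon>. real (emergence2 \<mu>\<^sub>o f \<epsilon>))) (Scl (\<lambda>\<epsilon>. real (emergence2 \<mu>\<^sub>1 f \<epsilon>)))"
proof -
  obtain \<Theta> where gauge: "scale_gauge Scl \<Theta>"
    using assms(9) scale_gauge_Dim scale_gauge_Ord by blast
  have sets: "sets \<mu> = sets borel" "sets \<mu>\<^sub>o = sets borel" "sets \<mu>\<^sub>1 = sets borel"
    using assms(3-5) by (auto simp: space_prob_algebra)
  interpret \<mu>: prob_space \<mu> using assms(3) by (simp add: space_prob_algebra)
  interpret \<mu>o: prob_space \<mu>\<^sub>o using assms(4) by (simp add: space_prob_algebra)
  interpret \<mu>1: prob_space \<mu>\<^sub>1 using assms(5) by (simp add: space_prob_algebra)
  have em: "emeasure \<mu> A = ennreal t * emeasure \<mu>\<^sub>o A + ennreal (1 - t) * emeasure \<mu>\<^sub>1 A"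
    if "A \<in> sets borel" for A
    using assms(6,7) that
    by (simp add: \<mu>.emeasure_eq_measure \<mu>o.emeasure_eq_measure \<mu>1.emeasure_eq_measure assms(8)
        ennreal_plus ennreal_mult)
  have upper: "(\<integral>\<^sup>+x. g x \<partial>\<mu>) \<le> ennreal t * (\<integral>\<^sup>+x. g x \<partial>\<mu>\<^sub>o) + ennreal (1 - t) * (\<integral>\<^sup>+x. g x \<partial>\<mu>\<^sub>1)" for g
    by (rule nn_integral_mixture_le) (simp_all add: sets em)
  have lower_o: "ennreal t * (\<integral>\<^sup>+x. g x \<partial>\<mu>\<^sub>o) \<le> (\<integral>\<^sup>+x. g x \<partial>\<mu>)" for g
    by (rule nn_integral_scaled_le) (simp_all add: sets em assms(6))
  have lower_1: "ennreal (1 - t) * (\<integral>\<^sup>+x. g x \<partial>\<mu>\<^sub>1) \<le> (\<integral>\<^sup>+x. g x \<partial>\<mu>)" for g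
    by (rule nn_integral_scaled_le) (simp_all add: sets em assms(7))
  have below: "(\<integral>\<^sup>+x. g x \<partial>\<mu>) \<le> d" if "(\<integral>\<^sup>+x. g x \<partial>\<mu>\<^sub>o) \<le> d" "(\<integral>\<^sup>+x. g x \<partial>\<mu>\<^sub>1) \<le> d" for g d
    using upper[of g] convex_combination_ennreal_le[OF _ _ that, of t] assms(6,7)
    by (meson less_imp_le order_trans)
  have "Scl (\<lambda>\<epsilon>. real (covering_number (limsup_integral \<mu>) f \<epsilon>)) =
      max (Scl (\<lambda>\<epsilon>. real (covering_number (limsup_integral \<mu>\<^sub>o) f \<epsilon>)))
        (Scl (\<lambda>\<epsilon>. real (covering_number (limsup_integral \<mu>\<^sub>1) f \<epsilon>)))"
  proof (rule scale_covering_number_eq_max[OF assms(1) gauge assms(6,7)])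
    show "K g \<le> d" if "K \<in> {limsup_integral \<mu>, limsup_integral \<mu>\<^sub>o, limsup_integral \<mu>\<^sub>1}"
      and "\<And>n x. n \<ge> 1 \<Longrightarrow> g n x \<le> d" for K g d
      using that(1) by (auto intro!: limsup_integral_le assms(3-5) that(2))
    show "K g \<le> K h" if "K \<in> {limsup_integral \<mu>\<^sub>o, limsup_integral \<mu>\<^sub>1}"
      and "\<And>n x. g n x \<le> h n x" for K g h
      using that by (auto intro!: Limsup_mono always_eventually nn_integral_mono)
    show "limsup_integral \<mu> g < e" if less: "limsup_integral \<mu>\<^sub>o g < e" "limsup_integral \<mu>\<^sub>1 g < e" for g e
    proof -
      \<comment> \<open>Below a common \<open>d < e\<close> the convex combination can be formed term by term in \<open>n\<close>.\<close>
      obtain d where d: "max (limsup_integral \<mu>\<^sub>o g) (limsup_integral \<mu>\<^sub>1 g) < d" "d < e"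
        using dense[of "max (limsup_integral \<mu>\<^sub>o g) (limsup_integral \<mu>\<^sub>1 g)" e] less by auto
      have "\<forall>\<^sub>F n in sequentially. (\<integral>\<^sup>+x. g n x \<partial>\<mu>\<^sub>o) < d" "\<forall>\<^sub>F n in sequentially. (\<integral>\<^sup>+x. g n x \<partial>\<mu>\<^sub>1) < d"
        using d(1) by (auto intro!: Limsup_lessD)
      then have "\<forall>\<^sub>F n in sequentially. (\<integral>\<^sup>+x. g n x \<partial>\<mu>) \<le> d"
        by eventually_elim (intro below less_imp_le)
      then have "limsup_integral \<mu> g \<le> d"
        by (rule Limsup_bounded)
      then show ?thesis
        using d(2) by (rule le_less_trans)
    qed
    show "limsup_integral \<mu>\<^sub>o g < ennreal \<epsilon>" if "limsup_integral \<mu> g < ennreal (t * \<epsilon>)" for g \<epsilon>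
      using limsup_less_if_scaled_less[OF assms(6) lower_o that] .
    show "limsup_integral \<mu>\<^sub>1 g < ennreal \<epsilon>" if "limsup_integral \<mu> g < ennreal ((1 - t) * \<epsilon>)" for g \<epsilon>
      using limsup_less_if_scaled_less[OF _ lower_1 that] assms(7) by simp
  qed
  moreover have "Scl (\<lambda>\<epsilon>. real (covering_number (integral_limsup \<mu>) f \<epsilon>)) =
      max (Scl (\<lambda>\<epsilon>. real (covering_number (integral_limsup \<mu>\<^sub>o) f \<epsilon>)))
        (Scl (\<lambda>\<epsilon>. real (covering_number (integral_limsup \<mu>\<^sub>1) f \<epsilon>)))"
  proof (rule scale_covering_number_eq_max[OF assms(1) gauge assms(6,7)])
    show "K g \<le> d" if "K \<in> {integral_limsup \<mu>, integral_limsup \<mu>\<^sub>o, integral_limsup \<mu>\<^sub>1}"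
      and "\<And>n x. n \<ge> 1 \<Longrightarrow> g n x \<le> d" for K g d
      using that(1) by (auto intro!: integral_limsup_le assms(3-5) that(2))
    show "K g \<le> K h" if "K \<in> {integral_limsup \<mu>\<^sub>o, integral_limsup \<mu>\<^sub>1}"
      and "\<And>n x. g n x \<le> h n x" for K g h
      using that by (auto intro!: Limsup_mono always_eventually nn_integral_mono)
    show "integral_limsup \<mu> g < e" if "integral_limsup \<mu>\<^sub>o g < e" "integral_limsup \<mu>\<^sub>1 g < e" for g e
      by (rule le_less_trans[OF below[OF max.cobounded1 max.cobounded2]]) (simp add: that)
    show "integral_limsup \<mu>\<^sub>o g < ennreal \<epsilon>" if "integral_limsup \<mu> g < ennreal (t * \<epsilon>)" for g \<epsilon>
      using less_if_scaled_less[OF assms(6) le_less_trans[OF lower_o that]] .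
    show "integral_limsup \<mu>\<^sub>1 g < ennreal \<epsilon>" if "integral_limsup \<mu> g < ennreal ((1 - t) * \<epsilon>)" for g \<epsilon>
      using less_if_scaled_less[OF _ le_less_trans[OF lower_1 that]] assms(7) by simp
  qed
  ultimately show ?thesis
    by (simp only: emergence_eq emergence2_eq)
qed

end
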